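(* Let $n\geq 3$. Every representation of $SB_n$ of one of the following two forms $\rho_1,\rho_2: SB_n\to\mathrm{GL}_n(\mathbb{C})$ is reducible. (1) For $1\le i\le n-1$, $$\rho_1(\sigma_i)=I_{i-1}\oplus\begin{pmatrix}a&\frac{1-a}{c}\\c&0\end{pmatrix}\oplus I_{n-i-1},\qquad \rho_1(\tau_i)=I_{i-1}\oplus\begin{pmatrix}1-(1-a)(1-t)&\frac{1-a}{c}(1-t)\\c(1-t)&t\end{pmatrix}\oplus I_{n-i-1},$$ where $a,c,t\in\mathbb{C}$, $a\neq0$, $a\neq 1$, $c\neq0$, and the matrices $\rho_1(\tau_i)$ are invertible. (2) For $1\le i\le n-1$, $$\rho_2(\sigma_i)=I_{i-1}\oplus\begin{pmatrix}0&\frac{1-d}{c}\\c&d\end{pmatrix}\oplus I_{n-i-1},\qquad \rho_2(\tau_i)=I_{i-1}\oplus\begin{pmatrix}x&\frac{1-d}{c}(1-x)\\c(1-x)&1-(1-d)(1-x)\end{pmatrix}\oplus I_{n-i-1},$$ where $c,d,x\in\mathbb{C}$, $c\neq0$, $d\neq0$, $d\neq 1$, and the matrices $\rho_2(\tau_i)$ are invertible.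
   Context: The singular braid group $SB_n$ is the group generated by $\sigma_1,\dots,\sigma_{n-1},\tau_1,\dots,\tau_{n-1}$ with defining relations: $\sigma_i\sigma_{i+1}\sigma_i=\sigma_{i+1}\sigma_i\sigma_{i+1}$, $\sigma_i\sigma_{i+1}\tau_i=\tau_{i+1}\sigma_i\sigma_{i+1}$ and $\sigma_{i+1}\sigma_i\tau_{i+1}=\tau_i\sigma_{i+1}\sigma_i$ for $1\le i\le n-2$; $\tau_i\sigma_i=\sigma_i\tau_i$ for $1\le i\le n-1$; and $\sigma_i\sigma_j=\sigma_j\sigma_i$, $\tau_i\tau_j=\tau_j\tau_i$, $\tau_i\sigma_j=\sigma_j\tau_i$ for $|i-j|\ge2$. $I_r$ is the $r\times r$ identity matrix and $\oplus$ denotes the block-diagonal sum of matrices. A representation $G\to\mathrm{GL}_m(\mathbb{C})$ is reducible if there is a subspace of $\mathbb{C}^m$, different from $0$ and $\mathbb{C}^m$, that is invariant under the image of $G$. *)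

theory Defs
  imports
    Complex_Main
    "HOL-Algebra.Group"
    "Jordan_Normal_Form.Matrix"
    "Jordan_Normal_Form.VS_Connect"
begin

text \<open>A letter \<open>(x, True)\<close> stands for the generator \<open>x\<close>, and \<open>(x, False)\<close> for its inverse.
  A relation \<open>r = s\<close> is a pair \<open>(r, s)\<close> of words.\<close>

type_synonym 'g word = "('g \<times> bool) list"

definition words :: "'g set \<Rightarrow> 'g word set" where
  "words X = lists (X \<times> UNIV)"

inductive pres_eq :: "'g set \<Rightarrow> ('g word \<times> 'g word) set \<Rightarrow> 'g word \<Rightarrow> 'g word \<Rightarrow> bool"
  for X R where
  refl: "w \<in> words X \<Longrightarrow> pres_eq X R w w"
| sym: "pres_eq X R u v \<Longrightarrow> pres_eq X R v u"
| trans: "pres_eq X R u v \<Longrightarrow> pres_eq X R v w \<Longrightarrow> pres_eq X R u w"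
| cancel: "u \<in> words X \<Longrightarrow> v \<in> words X \<Longrightarrow> x \<in> X \<Longrightarrow>
    pres_eq X R (u @ [(x, b), (x, \<not> b)] @ v) (u @ v)"
| relation: "(r, s) \<in> R \<Longrightarrow> r \<in> words X \<Longrightarrow> s \<in> words X \<Longrightarrow>
    u \<in> words X \<Longrightarrow> v \<in> words X \<Longrightarrow> pres_eq X R (u @ r @ v) (u @ s @ v)"

definition pres_rel :: "'g set \<Rightarrow> ('g word \<times> 'g word) set \<Rightarrow> ('g word \<times> 'g word) set" where
  "pres_rel X R = {(u, v). pres_eq X R u v}"

definition presented_group ::
    "'g set \<Rightarrow> ('g word \<times> 'g word) set \<Rightarrow> 'g word set monoid" where
  "presented_group X R = \<lparr>
     carrier = words X // pres_rel X R,
     mult = (\<lambda>A B. \<Union>u\<in>A. \<Union>v\<in>B. pres_rel X R `` {u @ v}),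
     one = pres_rel X R `` {[]}\<rparr>"

definition pres_gen :: "'g set \<Rightarrow> ('g word \<times> 'g word) set \<Rightarrow> 'g \<Rightarrow> 'g word set" where
  "pres_gen X R x = pres_rel X R `` {[(x, True)]}"

lemma words_simps [simp]:
  "[] \<in> words X" "a # u \<in> words X \<longleftrightarrow> fst a \<in> X \<and> u \<in> words X"
  "u @ v \<in> words X \<longleftrightarrow> u \<in> words X \<and> v \<in> words X"
  by (auto simp: words_def mem_Times_iff)

lemma pres_eq_words: "pres_eq X R u v \<Longrightarrow> u \<in> words X \<and> v \<in> words X"
  by (induction rule: pres_eq.induct) auto

lemma pres_eq_context:
  assumes "pres_eq X R u v" "p \<in> words X" "q \<in> words X"
  shows "pres_eq X R (p @ u @ q) (p @ v @ q)"
  using assms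
proof (induction rule: pres_eq.induct)
  case (cancel u v x b)
  then show ?case using pres_eq.cancel[of "p @ u" X "v @ q" x R b] by simp
next
  case (relation r s u v)
  then show ?case using pres_eq.relation[of r s R X "p @ u" "v @ q"] by simp
next
  case (refl w)
  then show ?case by (intro pres_eq.refl) simp
next
  case (sym u v)
  then show ?case by (blast intro: pres_eq.sym)
next
  case (trans u v w)
  then show ?case by (blast intro: pres_eq.trans)
qed

lemma pres_eq_append:
  assumes "pres_eq X R u u'" "pres_eq X R v v'"
  shows "pres_eq X R (u @ v) (u' @ v')"
proof (rule pres_eq.trans)
  show "pres_eq X R (u @ v) (u' @ v)"
    using pres_eq_context[OF assms(1), of "[]" v] pres_eq_words[OF assms(2)] by simp
  show "pres_eq X R (u' @ v) (u' @ v')"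
    using pres_eq_context[OF assms(2), of u' "[]"] pres_eq_words[OF assms(1)] by simp
qed

lemma equiv_pres_rel: "equiv (words X) (pres_rel X R)"
proof (rule equivI)
  show "pres_rel X R \<subseteq> words X \<times> words X"
    using pres_eq_words[of X R] by (fastforce simp: pres_rel_def)
  show "refl_on (words X) (pres_rel X R)"
    by (simp add: pres_rel_def refl_on_def pres_eq.refl)
  show "sym (pres_rel X R)"
    unfolding sym_def pres_rel_def by (blast intro: pres_eq.sym)
  show "trans (pres_rel X R)"
    unfolding trans_def pres_rel_def by (blast intro: pres_eq.trans)
qed

lemma pres_rel_Image_eq:
  assumes "pres_eq X R u v"
  shows "pres_rel X R `` {u} = pres_rel X R `` {v}"
  using equiv_class_eq[OF equiv_pres_rel, of u v X R] assms by (simp add: pres_rel_def)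

lemma UN_UN_const:
  assumes "\<And>x y. x \<in> A \<Longrightarrow> y \<in> B \<Longrightarrow> f x y = c" "a \<in> A" "b \<in> B"
  shows "(\<Union>x\<in>A. \<Union>y\<in>B. f x y) = c"
  using assms by blast

lemma presented_group_mult:
  assumes "u \<in> words X" "v \<in> words X"
  shows "pres_rel X R `` {u} \<otimes>\<^bsub>presented_group X R\<^esub> pres_rel X R `` {v} = pres_rel X R `` {u @ v}"
proof -
  have "pres_rel X R `` {u' @ v'} = pres_rel X R `` {u @ v}"
    if "u' \<in> pres_rel X R `` {u}" "v' \<in> pres_rel X R `` {v}" for u' v'
    using that pres_rel_Image_eq[OF pres_eq_append, of X R u u' v v'] by (simp add: pres_rel_def)
  moreover have "u \<in> pres_rel X R `` {u}" "v \<in> pres_rel X R `` {v}"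
    using assms by (auto simp: pres_rel_def intro: pres_eq.refl)
  ultimately have "(\<Union>u'\<in>pres_rel X R `` {u}. \<Union>v'\<in>pres_rel X R `` {v}.
      pres_rel X R `` {u' @ v'}) = pres_rel X R `` {u @ v}"
    by (intro UN_UN_const)
  then show ?thesis
    by (simp add: presented_group_def)
qed

lemma presented_group_carrierE:
  assumes "A \<in> carrier (presented_group X R)"
  obtains u where "u \<in> words X" "A = pres_rel X R `` {u}"
  using assms by (auto simp: presented_group_def elim: quotientE)

lemma presented_group_carrierI:
  "u \<in> words X \<Longrightarrow> pres_rel X R `` {u} \<in> carrier (presented_group X R)"
  by (auto simp: presented_group_def intro: quotientI)

definition inv_word :: "'g word \<Rightarrow> 'g word" where
  "inv_word u = rev (map (\<lambda>(x, b). (x, \<not> b)) u)"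

lemma inv_word_cancel:
  assumes "u \<in> words X"
  shows "inv_word u \<in> words X \<and> pres_eq X R (inv_word u @ u) []"
  using assms
proof (induction u)
  case Nil
  then show ?case by (auto simp: inv_word_def intro: pres_eq.refl)
next
  case (Cons a u)
  obtain x b where a: "a = (x, b)" by force
  from Cons a have IH: "inv_word u \<in> words X" "pres_eq X R (inv_word u @ u) []"
    and x: "x \<in> X" "u \<in> words X" by auto
  have "pres_eq X R (inv_word u @ [(x, \<not> b), (x, \<not> \<not> b)] @ u) (inv_word u @ u)"
    using IH(1) x by (intro pres_eq.cancel) auto
  then have "pres_eq X R (inv_word u @ [(x, \<not> b), (x, \<not> \<not> b)] @ u) []"
    using IH(2) by (rule pres_eq.trans)
  with IH(1) x a show ?case by (simp add: inv_word_def)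
qed

lemma group_presented_group: "group (presented_group X R)"
proof (rule groupI)
  show "\<one>\<^bsub>presented_group X R\<^esub> \<in> carrier (presented_group X R)"
    using presented_group_carrierI[of "[]" X R] by (simp add: presented_group_def)
next
  fix A B assume "A \<in> carrier (presented_group X R)" "B \<in> carrier (presented_group X R)"
  then show "A \<otimes>\<^bsub>presented_group X R\<^esub> B \<in> carrier (presented_group X R)"
    by (elim presented_group_carrierE) (simp add: presented_group_mult presented_group_carrierI)
next
  fix A B C assume "A \<in> carrier (presented_group X R)" "B \<in> carrier (presented_group X R)"
    "C \<in> carrier (presented_group X R)"
  then show "A \<otimes>\<^bsub>presented_group X R\<^esub> B \<otimes>\<^bsub>presented_group X R\<^esub> C =
      A \<otimes>\<^bsub>presented_group X R\<^esub> (B \<otimes>\<^bsub>presented_group X R\<^esub> C)"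
    by (elim presented_group_carrierE) (simp add: presented_group_mult)
next
  fix A assume "A \<in> carrier (presented_group X R)"
  then obtain u where u: "u \<in> words X" "A = pres_rel X R `` {u}"
    by (rule presented_group_carrierE)
  have one: "\<one>\<^bsub>presented_group X R\<^esub> = pres_rel X R `` {[]}"
    by (simp add: presented_group_def)
  show "\<one>\<^bsub>presented_group X R\<^esub> \<otimes>\<^bsub>presented_group X R\<^esub> A = A"
    unfolding one using presented_group_mult[of "[]" X u R] u by simp
  have "pres_rel X R `` {inv_word u @ u} = pres_rel X R `` {[]}"
    using inv_word_cancel[of u X R] u by (intro pres_rel_Image_eq) auto
  then show "\<exists>B\<in>carrier (presented_group X R).
      B \<otimes>\<^bsub>presented_group X R\<^esub> A = \<one>\<^bsub>presented_group X R\<^esub>"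
    unfolding one using inv_word_cancel[of u X R] u
    by (intro bexI[of _ "pres_rel X R `` {inv_word u}"])
      (simp_all add: presented_group_mult presented_group_carrierI)
qed

datatype sb_gen = Sig nat | Tau nat

definition sb_gens :: "nat \<Rightarrow> sb_gen set" where
  "sb_gens n = Sig ` {1..n - 1} \<union> Tau ` {1..n - 1}"

definition pos_word :: "'g list \<Rightarrow> 'g word" where
  "pos_word xs = map (\<lambda>x. (x, True)) xs"

inductive_set sb_pos_rels :: "nat \<Rightarrow> (sb_gen list \<times> sb_gen list) set" for n where
  "1 \<le> i \<Longrightarrow> i + 2 \<le> n \<Longrightarrow>
    ([Sig i, Sig (i+1), Sig i], [Sig (i+1), Sig i, Sig (i+1)]) \<in> sb_pos_rels n"
| "1 \<le> i \<Longrightarrow> i + 2 \<le> n \<Longrightarrow>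
    ([Sig i, Sig (i+1), Tau i], [Tau (i+1), Sig i, Sig (i+1)]) \<in> sb_pos_rels n"
| "1 \<le> i \<Longrightarrow> i + 2 \<le> n \<Longrightarrow>
    ([Sig (i+1), Sig i, Tau (i+1)], [Tau i, Sig (i+1), Sig i]) \<in> sb_pos_rels n"
| "1 \<le> i \<Longrightarrow> i + 1 \<le> n \<Longrightarrow>
    ([Tau i, Sig i], [Sig i, Tau i]) \<in> sb_pos_rels n"
| "i \<in> {1..n - 1} \<Longrightarrow> j \<in> {1..n - 1} \<Longrightarrow> \<bar>int i - int j\<bar> \<ge> 2 \<Longrightarrow>
    ([Sig i, Sig j], [Sig j, Sig i]) \<in> sb_pos_rels n"
| "i \<in> {1..n - 1} \<Longrightarrow> j \<in> {1..n - 1} \<Longrightarrow> \<bar>int i - int j\<bar> \<ge> 2 \<Longrightarrow>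
    ([Tau i, Tau j], [Tau j, Tau i]) \<in> sb_pos_rels n"
| "i \<in> {1..n - 1} \<Longrightarrow> j \<in> {1..n - 1} \<Longrightarrow> \<bar>int i - int j\<bar> \<ge> 2 \<Longrightarrow>
    ([Tau i, Sig j], [Sig j, Tau i]) \<in> sb_pos_rels n"

definition sb_rels :: "nat \<Rightarrow> (sb_gen word \<times> sb_gen word) set" where
  "sb_rels n = map_prod pos_word pos_word ` sb_pos_rels n"

definition SB :: "nat \<Rightarrow> sb_gen word set monoid" where
  "SB n = presented_group (sb_gens n) (sb_rels n)"

definition sb_sigma :: "nat \<Rightarrow> nat \<Rightarrow> sb_gen word set" where
  "sb_sigma n i = pres_gen (sb_gens n) (sb_rels n) (Sig i)"

definition sb_tau :: "nat \<Rightarrow> nat \<Rightarrow> sb_gen word set" where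
  "sb_tau n i = pres_gen (sb_gens n) (sb_rels n) (Tau i)"

text \<open>The membership conditions on \<open>r\<close> and \<open>s\<close> in \<open>pres_eq\<close> exclude none of the relations above.\<close>

lemma sb_rels_words: "(r, s) \<in> sb_rels n \<Longrightarrow> r \<in> words (sb_gens n) \<and> s \<in> words (sb_gens n)"
  by (auto simp: sb_rels_def pos_word_def sb_gens_def elim!: sb_pos_rels.cases)

definition GL :: "nat \<Rightarrow> complex mat monoid" where
  "GL m = units_of (ring_mat TYPE(complex) m ())"

text \<open>The name \<open>subspace\<close> is qualified because \<open>Complex_Main\<close> has another one.\<close>

definition reducible_rep :: "('g, 'b) monoid_scheme \<Rightarrow> nat \<Rightarrow> ('g \<Rightarrow> complex mat) \<Rightarrow> bool" where
  "reducible_rep G m \<rho> \<longleftrightarrow>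
    (\<exists>W. VectorSpace.subspace class_ring W (module_vec TYPE(complex) m) \<and>
         W \<noteq> {0\<^sub>v m} \<and> W \<noteq> carrier_vec m \<and>
         (\<forall>g\<in>carrier G. \<forall>w\<in>W. \<rho> g *\<^sub>v w \<in> W))"

definition local_block :: "nat \<Rightarrow> nat \<Rightarrow> complex list list \<Rightarrow> complex mat" where
  "local_block n i M = diag_block_mat [1\<^sub>m (i - 1), mat_of_rows_list 2 M, 1\<^sub>m (n - i - 1)]"

end

theory Submission
  imports Defs
begin

text \<open>The vector $(1, r, r^2, \dots, r^{n-1})$ with $r = c$ in the first case and $r = c/(1-d)$
  in the second is fixed by the images of all generators, since each $2\times 2$ block fixes
  $(1, r)$; it therefore spans an invariant line.\<close>

text \<open>The line spanned by \<open>v\<close> is invariant because each \<open>\<rho> g\<close>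
  is linear and fixes \<open>v\<close>. It is nonzero since \<open>v\<close> is, and the bound on
  \<open>m\<close> makes it a proper subspace.\<close>

lemma reducible_rep_fixed_vector:
  assumes m: "m \<ge> 2" and v: "v \<in> carrier_vec m" "v \<noteq> 0\<^sub>v m"
    and \<rho>: "\<And>g. g \<in> carrier G \<Longrightarrow> \<rho> g \<in> carrier_mat m m"
    and fixed: "\<And>g. g \<in> carrier G \<Longrightarrow> \<rho> g *\<^sub>v v = v"
  shows "reducible_rep G m \<rho>"
proof -
  interpret vec_space "TYPE(complex)" m .
  let ?W = "range (\<lambda>k. k \<cdot>\<^sub>v v)"
  have "submodule class_ring ?W V"
  proof (rule submodule.intro)
    show "Module.module class_ring V" by (rule module_axioms)
    show "?W \<subseteq> carrier V" using v by (auto simp: module_vec_simps)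
    fix x y assume "x \<in> ?W" "y \<in> ?W"
    then obtain k l where "x = k \<cdot>\<^sub>v v" "y = l \<cdot>\<^sub>v v" by auto
    then have "x + y = (k + l) \<cdot>\<^sub>v v" by (simp add: add_smult_distrib_vec)
    then show "x \<oplus>\<^bsub>V\<^esub> y \<in> ?W" by (simp add: module_vec_simps)
  next
    have "0\<^sub>v m = 0 \<cdot>\<^sub>v v" using v by auto
    then show "\<zero>\<^bsub>V\<^esub> \<in> ?W" by (auto simp: module_vec_simps)
  next
    fix k :: complex and x assume "x \<in> ?W"
    then show "k \<odot>\<^bsub>V\<^esub> x \<in> ?W" by (auto simp: module_vec_simps smult_smult_assoc)
  qed
  then have "VectorSpace.subspace class_ring ?W V"
    using vectorspace_axioms by (simp add: VectorSpace.subspace_def)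
  moreover have "?W \<noteq> {0\<^sub>v m}"
  proof
    assume "?W = {0\<^sub>v m}"
    then have "1 \<cdot>\<^sub>v v = 0\<^sub>v m" by blast
    with v show False by simp
  qed
  moreover have "?W \<noteq> carrier_vec m"
  proof
    assume "?W = carrier_vec m"
    \<comment> \<open>A line cannot contain the first two unit vectors: the first one forces
      \<open>v $ 1 = 0\<close>, which the second one contradicts.\<close>
    then obtain k l where k: "unit_vec m 0 = k \<cdot>\<^sub>v v" and l: "unit_vec m 1 = l \<cdot>\<^sub>v v"
      by (metis (no_types, lifting) imageE unit_vec_carrier)
    have "k * v $ 0 = 1" "k * v $ 1 = 0"
      using arg_cong[OF k, of "\<lambda>u. u $ 0"] arg_cong[OF k, of "\<lambda>u. u $ 1"] m v by auto
    moreover have "l * v $ 1 = 1"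
      using arg_cong[OF l, of "\<lambda>u. u $ 1"] m v by auto
    ultimately show False by auto
  qed
  moreover have "\<rho> g *\<^sub>v w \<in> ?W" if "g \<in> carrier G" "w \<in> ?W" for g w
    using that \<rho>[of g] fixed[of g] v by (auto simp: mult_mat_vec)
  ultimately show ?thesis
    unfolding reducible_rep_def by blast
qed

lemma GL_carrier_mat: "A \<in> carrier (GL m) \<Longrightarrow> A \<in> carrier_mat m m"
  by (auto simp: GL_def units_of_def Units_def ring_mat_simps)

lemma GL_simps: "A \<otimes>\<^bsub>GL m\<^esub> B = A * B" "\<one>\<^bsub>GL m\<^esub> = 1\<^sub>m m"
  by (simp_all add: GL_def units_of_def ring_mat_simps)

lemma group_GL: "group (GL m)"
proof -
  interpret ring "ring_mat TYPE(complex) m ()" by (rule ring_mat)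
  show ?thesis unfolding GL_def by (rule units_group)
qed

text \<open>The stabilizer of a vector is closed under products and inverses, so it is enough to
  test generators. Concretely this is an induction on a word representing \<open>g\<close>, peeling
  off one letter at a time.\<close>

lemma presented_group_fixed_vector:
  assumes hom: "\<rho> \<in> hom (presented_group X R) (GL m)"
    and v: "v \<in> carrier_vec m"
    and gens: "\<And>x. x \<in> X \<Longrightarrow> \<rho> (pres_gen X R x) *\<^sub>v v = v"
    and g: "g \<in> carrier (presented_group X R)"
  shows "\<rho> g *\<^sub>v v = v"
proof -
  let ?c = "\<lambda>u. pres_rel X R `` {u}"
  have mat: "\<rho> (?c u) \<in> carrier_mat m m" if "u \<in> words X" for u
    using hom_carrier[OF hom] presented_group_carrierI[OF that] GL_carrier_mat by blast
  have append: "\<rho> (?c (u @ w)) *\<^sub>v v = \<rho> (?c u) *\<^sub>v (\<rho> (?c w) *\<^sub>v v)"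
    if "u \<in> words X" "w \<in> words X" for u w
  proof -
    have "\<rho> (?c (u @ w)) = \<rho> (?c u) * \<rho> (?c w)"
      using that hom_mult[OF hom presented_group_carrierI presented_group_carrierI, of u w]
      by (simp add: presented_group_mult GL_simps)
    then show ?thesis
      using that mat v by (simp add: assoc_mult_mat_vec[of _ m m _ m])
  qed
  have empty: "\<rho> (?c []) *\<^sub>v v = v"
    using hom_one[OF hom group_presented_group group_GL] v
    by (simp add: GL_simps) (simp add: presented_group_def)
  have letter: "\<rho> (?c [(x, b)]) *\<^sub>v v = v" if x: "x \<in> X" for x b
  proof (cases b)
    case True
    with gens[OF x] show ?thesis by (simp add: pres_gen_def)
  next
    case False
    \<comment> \<open>The inverse letter is applied after the letter itself: the product acts
      trivially on \<open>v\<close>, and the letter already fixes \<open>v\<close>, so its inverse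
      must too.\<close>
    have "?c ([(x, False)] @ [(x, True)]) = ?c []"
      using pres_rel_Image_eq[OF pres_eq.cancel[of "[]" X "[]" x R False]] x by simp
    then have "\<rho> (?c [(x, False)]) *\<^sub>v (\<rho> (?c [(x, True)]) *\<^sub>v v) = v"
      using append[of "[(x, False)]" "[(x, True)]"] x empty by simp
    with False gens[OF x] show ?thesis by (simp add: pres_gen_def)
  qed
  obtain u where u: "u \<in> words X" "g = ?c u"
    using g by (rule presented_group_carrierE)
  from u(1) have "\<rho> (?c u) *\<^sub>v v = v"
  proof (induction u)
    case Nil
    show ?case by (rule empty)
  next
    case (Cons a u)
    obtain x b where a: "a = (x, b)" by force
    from Cons a append[of "[a]" u] letter[of x b] show ?case by simp
  qed
  with u show ?thesis by simp
qed

definition geom_vec :: "nat \<Rightarrow> complex \<Rightarrow> complex vec" where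
  "geom_vec n r = vec n (\<lambda>j. r ^ j)"

lemma geom_vec_carrier [simp]: "geom_vec n r \<in> carrier_vec n"
  by (simp add: geom_vec_def)

text \<open>Every tail of a geometric vector is a scalar multiple of a shorter geometric vector.
  Hence the two entries met by a block are proportional to $(1, r)$, wherever the block
  sits.\<close>

lemma geom_vec_append: "geom_vec (k + l) r = geom_vec k r @\<^sub>v r ^ k \<cdot>\<^sub>v geom_vec l r"
  by (rule eq_vecI) (auto simp: geom_vec_def simp flip: power_add)

text \<open>The two equations say that the block fixes $(1, r)$. Outside the block the matrix is the
  identity, and inside it acts on $r^{i-1} (1, r)$.\<close>

lemma local_block_geom_vec:
  assumes i: "1 \<le> i" "i + 1 \<le> n"
    and pq: "p + q * r = 1" "s + t * r = r"
  shows "local_block n i [[p, q], [s, t]] *\<^sub>v geom_vec n r = geom_vec n r"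
proof -
  let ?M = "mat_of_rows_list 2 [[p, q], [s, t]]"
  \<comment> \<open>Vector indices start at 0, so the block occupies positions \<open>k\<close> and
    \<open>k + 1\<close>; the bounds on \<open>i\<close> ensure that neither subtraction is
    truncated.\<close>
  define k l where "k = i - 1" and "l = n - i - 1"
  have n: "n = k + (2 + l)" using i by (simp add: k_def l_def)
  have M: "?M \<in> carrier_mat 2 2" by (intro carrier_matI) (simp_all add: mat_of_rows_list_def)
  have M_fix: "?M *\<^sub>v geom_vec 2 r = geom_vec 2 r"
    by (rule eq_vecI)
      (use pq in \<open>auto simp: mat_of_rows_list_def geom_vec_def scalar_prod_def numeral_2_eq_2 less_Suc_eq\<close>)
  let ?B = "four_block_mat ?M (0\<^sub>m 2 l) (0\<^sub>m l 2) (1\<^sub>m l)"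
  have B: "?B \<in> carrier_mat (2 + l) (2 + l)" using M by auto
  have B_fix: "?B *\<^sub>v geom_vec (2 + l) r = geom_vec (2 + l) r"
    unfolding geom_vec_append
    by (subst mult_mat_vec_split[OF M]) (simp_all add: M_fix)
  \<comment> \<open>Restricting the recursive equation to lists with nonempty tail stops the
    unfolding at the last summand, so that no empty block is appended.\<close>
  have block: "local_block n i [[p, q], [s, t]] =
      four_block_mat (1\<^sub>m k) (0\<^sub>m k (2 + l)) (0\<^sub>m (2 + l) k) ?B"
    using M unfolding local_block_def diag_block_mat.simps(2)[of _ "_ # _"] diag_block_mat_singleton
    by (simp add: k_def l_def Let_def)
  show ?thesis
    \<comment> \<open>The tail carries the factor \<open>r ^ k\<close>, which
      \<open>mult_mat_vec\<close> moves past the matrix so that \<open>B_fix\<close>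
      applies.\<close>
    unfolding block unfolding n geom_vec_append[of k]
    by (subst mult_mat_vec_split[OF _ B]) (simp_all add: mult_mat_vec[OF B] B_fix del: add_2_eq_Suc)
qed

text \<open>Covers both families at once: the entries stay arbitrary, and all that matters is that
  the blocks of both kinds of generators fix $(1, r)$ for one common \<open>r\<close>.\<close>

lemma SB_reducible_of_blocks:
  assumes n: "n \<ge> 2" and hom: "\<rho> \<in> hom (SB n) (GL n)"
    and sigma: "\<And>i. i \<in> {1..n - 1} \<Longrightarrow>
      \<rho> (sb_sigma n i) = local_block n i [[p, q], [s, t]]"
    and tau: "\<And>i. i \<in> {1..n - 1} \<Longrightarrow>
      \<rho> (sb_tau n i) = local_block n i [[p', q'], [s', t']]"
    and "p + q * r = 1" "s + t * r = r" "p' + q' * r = 1" "s' + t' * r = r"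
  shows "reducible_rep (SB n) n \<rho>"
proof (rule reducible_rep_fixed_vector[OF n geom_vec_carrier])
  \<comment> \<open>The entry at index 0 is \<open>r ^ 0 = 1\<close>, whatever \<open>r\<close>
    is.\<close>
  have "geom_vec n r $ 0 \<noteq> 0\<^sub>v n $ 0"
    using n by (simp add: geom_vec_def)
  then show "geom_vec n r \<noteq> 0\<^sub>v n" by metis
next
  fix g assume g: "g \<in> carrier (SB n)"
  then show "\<rho> g \<in> carrier_mat n n"
    using hom_carrier[OF hom] GL_carrier_mat by blast
  have "\<rho> (pres_gen (sb_gens n) (sb_rels n) x) *\<^sub>v geom_vec n r = geom_vec n r"
    if x: "x \<in> sb_gens n" for x
  proof -
    consider i where "x = Sig i" "i \<in> {1..n - 1}" | i where "x = Tau i" "i \<in> {1..n - 1}"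
      using x unfolding sb_gens_def by blast
    then show ?thesis
      by cases (use assms in \<open>auto simp: local_block_geom_vec simp flip: sb_sigma_def sb_tau_def\<close>)
  qed
  then show "\<rho> g *\<^sub>v geom_vec n r = geom_vec n r"
    using presented_group_fixed_vector hom g unfolding SB_def by (metis geom_vec_carrier)
qed

theorem theorem28:
  fixes n :: nat
  assumes "n \<ge> 3"
  shows "(\<forall>(\<rho>\<^sub>1 :: sb_gen word set \<Rightarrow> complex mat) (a :: complex) (c :: complex) (t :: complex).
            \<rho>\<^sub>1 \<in> hom (SB n) (GL n) \<and> a \<noteq> 0 \<and> a \<noteq> 1 \<and> c \<noteq> 0 \<and>
            (\<forall>i\<in>{1..n - 1}. \<rho>\<^sub>1 (sb_sigma n i) =
               local_block n i [[a, (1 - a) / c],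
                                [c, 0]]) \<and>
            (\<forall>i\<in>{1..n - 1}. \<rho>\<^sub>1 (sb_tau n i) =
               local_block n i [[1 - (1 - a) * (1 - t), (1 - a) / c * (1 - t)],
                                [c * (1 - t), t]]) \<and>
            (\<forall>i\<in>{1..n - 1}. invertible_mat (\<rho>\<^sub>1 (sb_tau n i)))
            \<longrightarrow> reducible_rep (SB n) n \<rho>\<^sub>1)
       \<and> (\<forall>(\<rho>\<^sub>2 :: sb_gen word set \<Rightarrow> complex mat) (c :: complex) (d :: complex) (x :: complex).
            \<rho>\<^sub>2 \<in> hom (SB n) (GL n) \<and> c \<noteq> 0 \<and> d \<noteq> 0 \<and> d \<noteq> 1 \<and>
            (\<forall>i\<in>{1..n - 1}. \<rho>\<^sub>2 (sb_sigma n i) =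
               local_block n i [[0, (1 - d) / c],
                                [c, d]]) \<and>
            (\<forall>i\<in>{1..n - 1}. \<rho>\<^sub>2 (sb_tau n i) =
               local_block n i [[x, (1 - d) / c * (1 - x)],
                                [c * (1 - x), 1 - (1 - d) * (1 - x)]]) \<and>
            (\<forall>i\<in>{1..n - 1}. invertible_mat (\<rho>\<^sub>2 (sb_tau n i)))
            \<longrightarrow> reducible_rep (SB n) n \<rho>\<^sub>2)"
proof (intro conjI allI impI; elim conjE)
  fix \<rho> :: "sb_gen word set \<Rightarrow> complex mat" and a c t :: complex
  assume c: "c \<noteq> 0" and hom: "\<rho> \<in> hom (SB n) (GL n)"
    and sigma: "\<forall>i\<in>{1..n - 1}. \<rho> (sb_sigma n i) =
      local_block n i [[a, (1 - a) / c], [c, 0]]"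
    and tau: "\<forall>i\<in>{1..n - 1}. \<rho> (sb_tau n i) =
      local_block n i [[1 - (1 - a) * (1 - t), (1 - a) / c * (1 - t)], [c * (1 - t), t]]"
  \<comment> \<open>The second row of the block of \<open>sb_sigma\<close>, with its zero entry,
    forces \<open>r = c\<close>; the other three equations then hold.\<close>
  show "reducible_rep (SB n) n \<rho>"
    by (rule SB_reducible_of_blocks[where r = c, OF _ hom sigma[rule_format] tau[rule_format]])
      (use assms c in \<open>simp_all add: field_simps\<close>)
next
  fix \<rho> :: "sb_gen word set \<Rightarrow> complex mat" and c d x :: complex
  assume c: "c \<noteq> 0" and d: "d \<noteq> 1" and hom: "\<rho> \<in> hom (SB n) (GL n)"
    and sigma: "\<forall>i\<in>{1..n - 1}. \<rho> (sb_sigma n i) =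
      local_block n i [[0, (1 - d) / c], [c, d]]"
    and tau: "\<forall>i\<in>{1..n - 1}. \<rho> (sb_tau n i) =
      local_block n i [[x, (1 - d) / c * (1 - x)],
                       [c * (1 - x), 1 - (1 - d) * (1 - x)]]"
  have "1 - d \<noteq> 0" using d by simp
  \<comment> \<open>Here the zero is in the first row, which reads
    \<open>(1 - d) / c * r = 1\<close> and so determines \<open>r\<close>, as \<open>1 - d\<close>
    is nonzero.\<close>
  show "reducible_rep (SB n) n \<rho>"
    by (rule SB_reducible_of_blocks[where r = "c / (1 - d)",
          OF _ hom sigma[rule_format] tau[rule_format]])
      (use assms c \<open>1 - d \<noteq> 0\<close> in \<open>simp_all add: divide_simps, simp_all add: algebra_simps\<close>)
qed

end
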